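(* Let $M \subset \mathbb{A}^3$ be the affine Markoff surface $x^2+y^2+z^2 = xyz$, and let $\phi_1,\phi_2,\phi_3$ be its automorphisms $\phi_1(x,y,z) = (yz-x,\,y,\,z)$, $\phi_2(x,y,z) = (x,\,xz-y,\,z)$, $\phi_3(x,y,z) = (x,\,y,\,xy-z)$. Fix distinct $i,j \in \{1,2,3\}$ and put $f = \phi_i\circ\phi_j$, with forbidden set $\mathcal{F}_1 = \{(0,0,0)\}$. Then: (1) There exists a finite set $S$ of primes such that for every prime $p \notin S$ there is a point $P \in M(\mathbb{F}_p)$ with $P \neq (0,0,0)$ and $f_p^n(P) = P$ for some integer $1 \le n \le 3$; that is, the system $(M, f, \mathcal{F}_1)$ is strongly residually periodic over $\mathbb{Q}$ with bound $3$. (2) The bound $3$ is sharp: there is no finite set $S$ of primes such that for every prime $p\notin S$ there is a point $P \in M(\mathbb{F}_p)$ with $P \neq (0,0,0)$ and $f_p^n(P)=P$ for some $1 \le n \le 2$.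
   Context: For a prime $p$, $M(\mathbb{F}_p)$ denotes the set of $(x,y,z)\in\mathbb{F}_p^3$ with $x^2+y^2+z^2=xyz$ in $\mathbb{F}_p$, and $f_p$ denotes the map on $M(\mathbb{F}_p)$ given by the same polynomial formulas as $f$, reduced modulo $p$. In general, a dynamical system $(X,f,\mathcal{F})$ over $\mathbb{Q}$ (variety $X$, endomorphism $f$, algebraic "forbidden" subset $\mathcal{F}$) is called strongly residually periodic with bound $B$ (SRP($B$)) if there is a finite set of primes $S$ such that for every prime $p\notin S$ the reduction $f_p$ has an $\mathbb{F}_p$-point $P$ of $X_p$ with $f_p^n(P)=P$ for some $1\le n\le B$ and $P$ not in the reduction modulo $p$ of $\mathcal{F}$. *)

theory Defs
  imports "HOL-Number_Theory.Residues"
begin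

text \<open>
  The surface and its automorphisms are given by polynomials with integer coefficients, so they
  are defined over an arbitrary ring \<open>R\<close>; taking \<open>R = residue_ring p\<close> gives the reduction
  modulo \<open>p\<close>.
\<close>

definition markoff :: "('a, 'b) ring_scheme \<Rightarrow> ('a \<times> 'a \<times> 'a) set" where
  "markoff R = {(x, y, z). x \<in> carrier R \<and> y \<in> carrier R \<and> z \<in> carrier R \<and>
     x [^]\<^bsub>R\<^esub> (2::nat) \<oplus>\<^bsub>R\<^esub> y [^]\<^bsub>R\<^esub> (2::nat) \<oplus>\<^bsub>R\<^esub> z [^]\<^bsub>R\<^esub> (2::nat)
       = x \<otimes>\<^bsub>R\<^esub> y \<otimes>\<^bsub>R\<^esub> z}"

definition phi1 :: "('a, 'b) ring_scheme \<Rightarrow> 'a \<times> 'a \<times> 'a \<Rightarrow> 'a \<times> 'a \<times> 'a" where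
  "phi1 R = (\<lambda>(x, y, z). (y \<otimes>\<^bsub>R\<^esub> z \<ominus>\<^bsub>R\<^esub> x, y, z))"

definition phi2 :: "('a, 'b) ring_scheme \<Rightarrow> 'a \<times> 'a \<times> 'a \<Rightarrow> 'a \<times> 'a \<times> 'a" where
  "phi2 R = (\<lambda>(x, y, z). (x, x \<otimes>\<^bsub>R\<^esub> z \<ominus>\<^bsub>R\<^esub> y, z))"

definition phi3 :: "('a, 'b) ring_scheme \<Rightarrow> 'a \<times> 'a \<times> 'a \<Rightarrow> 'a \<times> 'a \<times> 'a" where
  "phi3 R = (\<lambda>(x, y, z). (x, y, x \<otimes>\<^bsub>R\<^esub> y \<ominus>\<^bsub>R\<^esub> z))"

text \<open>Only the indices 1, 2, 3 are meaningful.\<close>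

definition phi :: "nat \<Rightarrow> ('a, 'b) ring_scheme \<Rightarrow> 'a \<times> 'a \<times> 'a \<Rightarrow> 'a \<times> 'a \<times> 'a" where
  "phi i = (if i = 1 then phi1 else if i = 2 then phi2 else phi3)"

definition forbidden1 :: "('a, 'b) ring_scheme \<Rightarrow> ('a \<times> 'a \<times> 'a) set" where
  "forbidden1 R = {(\<zero>\<^bsub>R\<^esub>, \<zero>\<^bsub>R\<^esub>, \<zero>\<^bsub>R\<^esub>)}"

lemma (in cring) phi_markoff:
  assumes "P \<in> markoff R"
  shows "phi i R P \<in> markoff R"
proof -
  have key: "(b \<otimes> c \<ominus> a) [^] (2::nat) \<oplus> b [^] (2::nat) \<oplus> c [^] (2::nat) = (b \<otimes> c \<ominus> a) \<otimes> b \<otimes> c"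
    if "a \<in> carrier R" "b \<in> carrier R" "c \<in> carrier R"
      and e: "a [^] (2::nat) \<oplus> b [^] (2::nat) \<oplus> c [^] (2::nat) = a \<otimes> b \<otimes> c" for a b c
  proof -
    have "(b \<otimes> c \<ominus> a) [^] (2::nat) \<oplus> b [^] (2::nat) \<oplus> c [^] (2::nat)
        = (b \<otimes> c) \<otimes> (b \<otimes> c) \<ominus> a \<otimes> b \<otimes> c \<ominus> a \<otimes> b \<otimes> c
          \<oplus> (a [^] (2::nat) \<oplus> b [^] (2::nat) \<oplus> c [^] (2::nat))"
      using that(1-3) by (simp add: numeral_2_eq_2) algebra
    also have "\<dots> = (b \<otimes> c \<ominus> a) \<otimes> b \<otimes> c"
      unfolding e using that(1-3) by algebra
    finally show ?thesis .
  qed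
  obtain x y z where P: "P = (x, y, z)" by (cases P)
  have c: "x \<in> carrier R" "y \<in> carrier R" "z \<in> carrier R"
    and e: "x [^] (2::nat) \<oplus> y [^] (2::nat) \<oplus> z [^] (2::nat) = x \<otimes> y \<otimes> z"
    using assms by (auto simp: markoff_def P)
  show ?thesis
    using c e key[of x y z] key[of y x z] key[of z x y]
    by (auto simp: P phi_def phi1_def phi2_def phi3_def markoff_def a_ac m_ac)
qed

text \<open>
  Strong residual periodicity with bound \<open>B\<close>: \<open>X\<close>, \<open>f\<close>, \<open>F\<close> assign to a ring the points of the
  variety, the self-map, and the forbidden subset, and are evaluated at the prime fields only.
\<close>

definition strongly_residually_periodic ::
  "nat \<Rightarrow> (int ring \<Rightarrow> 'c set) \<Rightarrow> (int ring \<Rightarrow> 'c \<Rightarrow> 'c) \<Rightarrow> (int ring \<Rightarrow> 'c set) \<Rightarrow> bool" where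
  "strongly_residually_periodic B X f F \<longleftrightarrow>
     (\<exists>S :: nat set. finite S \<and> (\<forall>p\<in>S. prime p) \<and>
        (\<forall>p. prime p \<and> p \<notin> S \<longrightarrow>
           (\<exists>P \<in> X (residue_ring (int p)). P \<notin> F (residue_ring (int p)) \<and>
              (\<exists>n. 1 \<le> n \<and> n \<le> B \<and> (f (residue_ring (int p)) ^^ n) P = P))))"

end

theory Submission
  imports Defs
begin

text \<open>
  The map \<open>f\<close> fixes one coordinate, say \<open>z\<close>, and acts on the other two as the square of the
  recurrence \<open>u\<^sub>n\<^sub>+\<^sub>1 = z u\<^sub>n - u\<^sub>n\<^sub>-\<^sub>1\<close>. For \<open>z = 1\<close> this recurrence has period six, so every point with
  \<open>z = 1\<close> has period dividing three under \<open>f\<close>; such points exist because the conic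
  \<open>x\<^sup>2 + y\<^sup>2 + 1 = x y\<close> has a point modulo every prime \<open>p > 3\<close>. Conversely, period at most two
  forces \<open>z = 0\<close> and \<open>x\<^sup>2 + y\<^sup>2 = 0\<close>, which for \<open>p \<equiv> 3\<close> modulo four leaves only the origin.
\<close>

section \<open>Sums of two squares and primes congruent to 3 modulo 4\<close>

text \<open>If \<open>p\<close> does not divide \<open>x\<close>, it does not divide
  \<open>y\<close> either. Raising \<open>x\<^sup>2 = - (y\<^sup>2)\<close> to the power (p-1)/2,
  which is odd here, then gives 1 = -1 modulo \<open>p\<close> by Fermat.\<close>

lemma sum_squares_dvd_3_mod_4:
  fixes x y :: int and p :: nat
  assumes p: "prime p" "p mod 4 = 3" and d: "int p dvd x\<^sup>2 + y\<^sup>2"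
  shows "int p dvd x"
proof (rule ccontr)
  assume nx: "\<not> int p dvd x"
  have pp: "prime (int p)" using p by simp
  have ny: "\<not> int p dvd y"
  proof
    assume "int p dvd y"
    then have "int p dvd y\<^sup>2" by (simp add: power2_eq_square)
    with d have "int p dvd x\<^sup>2" by (simp add: dvd_add_left_iff)
    with nx pp show False using prime_dvd_power by blast
  qed
  define k where "k = (p - 1) div 2"
  have k: "p - 1 = 2 * k" "odd k" using p(2) unfolding k_def by presburger+
  have fermat: "[a ^ (2 * k) = 1] (mod int p)" if "\<not> int p dvd a" for a
  proof -
    interpret residues_prime p "residue_ring (int p)" 
      by unfold_locales (use p in auto)
    show ?thesis
      using euler_theorem[of a] that p(1) k(1) by (simp add: p_coprime_right_int totient_prime)
  qed
  have "[x\<^sup>2 = - (y\<^sup>2)] (mod int p)" using d by (simp add: cong_iff_dvd_diff)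
  then have "[(x\<^sup>2) ^ k = (- (y\<^sup>2)) ^ k] (mod int p)" by (rule cong_pow)
  then have "[x ^ (2 * k) = - (y ^ (2 * k))] (mod int p)"
    using k(2) by (simp add: power_mult)
  with fermat[OF nx] fermat[OF ny] have "[1 = - 1] (mod int p)"
    by (meson cong_minus_minus_iff cong_sym cong_trans)
  then have "int p dvd 2" by (simp add: cong_iff_dvd_diff)
  then have "p \<le> 2" using zdvd_imp_le by fastforce
  with p show False using prime_ge_2_nat[of p] by auto
qed

text \<open>A product is 3 modulo 4 only if one of its two factors is. So either the chosen prime
  factor works, or the smaller cofactor is again 3 modulo 4 and induction applies.\<close>

lemma exists_prime_3_mod_4_dvd:
  fixes n :: nat
  assumes "n mod 4 = 3"
  shows "\<exists>p. prime p \<and> p dvd n \<and> p mod 4 = 3"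
  using assms
proof (induction n rule: less_induct)
  case (less n)
  then obtain p where p: "prime p" "p dvd n"
    using prime_factor_nat[of n] by fastforce
  then obtain m where m: "n = p * m" by (elim dvdE)
  have "p mod 4 * (m mod 4) mod 4 = 3"
    using less.prems m by (simp add: mod_mult_eq)
  moreover have "p mod 4 \<in> {0,1,2,3}" "m mod 4 \<in> {0,1,2,3}" by auto
  ultimately consider "p mod 4 = 3" | "m mod 4 = 3" by fastforce
  then show ?case
  proof cases
    case 2
    moreover have "m < n" using 2 p(1) m prime_gt_1_nat[of p] n_less_m_mult_n[of m p] by (cases "m = 0") auto
    ultimately show ?thesis using less.IH[of m] m by auto
  qed (use p in blast)
qed

text \<open>Euclid's argument with 4Q - 1: its residue 3 modulo 4 forces a prime factor from the
  supposedly finite set, and that prime also divides Q.\<close>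

lemma infinite_primes_3_mod_4: "infinite {p::nat. prime p \<and> p mod 4 = 3}"
proof
  assume fin: "finite {p::nat. prime p \<and> p mod 4 = 3}"
  define Q where "Q = \<Prod>{p::nat. prime p \<and> p mod 4 = 3}"
  \<comment> \<open>Positivity makes the natural-number subtraction in \<open>N\<close>
    exact.\<close>
  have "Q > 0"
    unfolding Q_def by (rule prod_pos) (auto simp: prime_gt_0_nat)
  then obtain k where k: "Q = Suc k" using gr0_conv_Suc by blast
  define N where "N = 4 * Q - 1"
  have "N = 4 * k + 3" unfolding N_def k by simp
  then have "N mod 4 = 3" by simp
  then obtain p where p: "prime p" "p dvd N" "p mod 4 = 3"
    using exists_prime_3_mod_4_dvd by blast
  have "p dvd Q"
    unfolding Q_def using fin p by (intro dvd_prodI[where f = "\<lambda>x. x"]) auto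
  moreover have "N + 1 = 4 * Q" unfolding N_def k by simp
  ultimately have "p dvd N + 1" by simp
  with p(2) have "p dvd 1" using dvd_add_right_iff by blast
  with p(1) show False by simp
qed

section \<open>Points on conics modulo p\<close>

text \<open>The difference of two values is \<open>c * ((u - v) * (u + v))\<close>. On this half
  range, \<open>u - v\<close> and \<open>u + v\<close> are below \<open>p\<close> in absolute value,
  so a factor divisible by \<open>p\<close> vanishes.\<close>

lemma inj_on_square_mod_prime:
  fixes p :: nat and c d :: int
  assumes p: "prime p" and c: "\<not> int p dvd c"
  shows "inj_on (\<lambda>u. (c * u\<^sup>2 + d) mod int p) {u. 0 \<le> u \<and> 2 * u < int p}"
proof (rule inj_onI)
  fix u v :: int
  assume u: "u \<in> {u. 0 \<le> u \<and> 2 * u < int p}" and v: "v \<in> {u. 0 \<le> u \<and> 2 * u < int p}"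
    and e: "(c * u\<^sup>2 + d) mod int p = (c * v\<^sup>2 + d) mod int p"
  have "int p dvd c * ((u - v) * (u + v))"
    using e by (simp add: mod_eq_dvd_iff algebra_simps power2_eq_square)
  then have "int p dvd u - v \<or> int p dvd u + v"
    using p c by (simp add: prime_dvd_mult_iff)
  then show "u = v"
  proof
    assume "int p dvd u - v"
    moreover have "\<bar>u - v\<bar> < int p" using u v by auto
    ultimately show ?thesis using dvd_imp_le_int[of "u - v" "int p"] by fastforce
  next
    assume "int p dvd u + v"
    moreover have "\<bar>u + v\<bar> < int p" using u v by auto
    ultimately have "u + v = 0" using dvd_imp_le_int[of "u + v" "int p"] by fastforce
    then show ?thesis using u v by auto
  qed
qed

text \<open>Pigeonhole: \<open>u\<^sup>2\<close> and \<open>- a * v\<^sup>2 - d\<close> each take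
  (p+1)/2 values modulo \<open>p\<close>. Together that is p+1, so the two value sets meet.\<close>

lemma exists_diagonal_conic_mod_prime:
  fixes p :: nat and a d :: int
  assumes p: "prime p" "odd p" and a: "\<not> int p dvd a"
  shows "\<exists>u v. int p dvd u\<^sup>2 + a * v\<^sup>2 + d"
proof -
  let ?I = "{u::int. 0 \<le> u \<and> 2 * u < int p}"
  let ?A = "(\<lambda>u. (1 * u\<^sup>2 + 0) mod int p) ` ?I"
  let ?B = "(\<lambda>v. ((- a) * v\<^sup>2 + (- d)) mod int p) ` ?I"
  have p0: "int p > 0" using p prime_gt_0_nat by auto
  obtain k where k: "p = 2 * k + 1" using p(2) by (elim oddE)
  have I: "?I = {0..int k}" unfolding k by auto
  have cI: "2 * card ?I = p + 1" unfolding I by (simp add: k)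
  have p1: "\<not> int p dvd 1" using prime_gt_1_nat[OF p(1)] by simp
  have cA: "card ?A = card ?I"
    by (rule card_image) (rule inj_on_square_mod_prime[OF p(1) p1])
  have cB: "card ?B = card ?I"
    by (rule card_image) (rule inj_on_square_mod_prime, use p a in auto)
  have "?A \<inter> ?B \<noteq> {}"
  proof
    assume "?A \<inter> ?B = {}"
    then have "card (?A \<union> ?B) = card ?A + card ?B"
      by (intro card_Un_disjoint) (auto simp: I)
    moreover have "card (?A \<union> ?B) \<le> card {0..<int p}"
      using p0 by (intro card_mono) auto
    ultimately show False using cI cA cB by simp
  qed
  then obtain u v where "(1 * u\<^sup>2 + 0) mod int p = ((- a) * v\<^sup>2 + (- d)) mod int p" by blast
  then show ?thesis by (auto simp: mod_eq_dvd_iff algebra_simps)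
qed

text \<open>Completing the square, 4(x^2 + y^2 + 1 - xy) = (2x - y)^2 + 3y^2 + 4. A point of the
  diagonal conic with u = 2x - y and v = y is pulled back by x = (u + v)/2.\<close>

lemma exists_norm_form_mod_prime:
  fixes p :: nat
  assumes p: "prime p" "p \<noteq> 2" "p \<noteq> 3"
  shows "\<exists>x y. 0 \<le> x \<and> x < int p \<and> 0 \<le> y \<and> y < int p \<and> (x\<^sup>2 + y\<^sup>2 + 1) mod int p = x * y mod int p"
proof -
  have odd: "odd p" using p prime_odd_nat prime_ge_2_nat[of p] by force
  have p0: "int p > 0" using p prime_gt_0_nat by auto
  have n3: "\<not> int p dvd 3"
  proof
    assume "int p dvd 3"
    then have "p dvd 3" by presburger
    then show False using p primes_dvd_imp_eq[of p 3] by simp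
  qed
  obtain u v where uv: "int p dvd u\<^sup>2 + 3 * v\<^sup>2 + 4"
    using exists_diagonal_conic_mod_prime[OF p(1) odd n3] by blast
  \<comment> \<open>An inverse of 2 modulo \<open>p\<close>; the error from
    \<open>2 * h = int p + 1\<close> is collected below as a multiple of \<open>p\<close>.\<close>
  define h where "h = (int p + 1) div 2"
  have h: "2 * h = int p + 1" unfolding h_def using odd by presburger
  let ?x = "(u + v) * h" 
  have "4 * (?x\<^sup>2 + v\<^sup>2 + 1 - ?x * v) = ((u + v) * (2 * h))\<^sup>2 + 4 * v\<^sup>2 + 4 - 2 * ((u + v) * (2 * h)) * v"
    by (simp add: algebra_simps power2_eq_square)
  also have "\<dots> = (u\<^sup>2 + 3 * v\<^sup>2 + 4) + int p * ((u + v)\<^sup>2 * (int p + 2) - 2 * (u + v) * v)"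
    unfolding h by (simp add: algebra_simps power2_eq_square)
  finally have "int p dvd 4 * (?x\<^sup>2 + v\<^sup>2 + 1 - ?x * v)"
    using uv by (simp only: dvd_add dvd_triv_left)
  moreover have "coprime (int p) 4"
    using odd coprime_power_right_iff[of "int p" 2 2] by simp
  ultimately have "int p dvd ?x\<^sup>2 + v\<^sup>2 + 1 - ?x * v" using coprime_dvd_mult_right_iff by blast
  then have e: "[?x\<^sup>2 + v\<^sup>2 + 1 = ?x * v] (mod int p)" by (simp add: cong_iff_dvd_diff)
  have "[(?x mod int p)\<^sup>2 + (v mod int p)\<^sup>2 + 1 = ?x\<^sup>2 + v\<^sup>2 + 1] (mod int p)"
    by (intro cong_add cong_pow) simp_all
  also note e
  also have "[?x * v = (?x mod int p) * (v mod int p)] (mod int p)"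
    by (intro cong_mult) simp_all
  finally have "((?x mod int p)\<^sup>2 + (v mod int p)\<^sup>2 + 1) mod int p = (?x mod int p) * (v mod int p) mod int p"
    by (simp only: cong_def)
  moreover have "0 \<le> ?x mod int p" "?x mod int p < int p" "0 \<le> v mod int p" "v mod int p < int p"
    using p0 by auto
  ultimately show ?thesis by blast
qed

section \<open>Excluding cycles of length at most two\<close>

text \<open>If \<open>z\<close> is a unit, period two forces a fixed point, where \<open>x y z = 2 x\<^sup>2 = 2 y\<^sup>2\<close>
  and hence \<open>z\<^sup>2 = 0\<close>.\<close>

lemma markoff_no_short_cycle:
  fixes p :: nat and x y z :: int
  assumes p: "prime p" "p mod 4 = 3"
    and r: "x \<in> {0..<int p}" "y \<in> {0..<int p}" "z \<in> {0..<int p}"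
    and M: "(x\<^sup>2 + y\<^sup>2 + z\<^sup>2) mod int p = x * y * z mod int p"
    and y2: "((((x * z - y) mod int p * z - x) mod int p) * z - (x * z - y) mod int p) mod int p = y"
    and x2: "(y * z - ((x * z - y) mod int p * z - x) mod int p) mod int p = x"
  shows "x = 0 \<and> y = 0 \<and> z = 0"
proof -
  have pp: "prime (int p)" using p by simp
  have p2: "\<not> int p dvd 2"
    using p zdvd_imp_le[of "int p" 2] prime_ge_2_nat[of p] by fastforce
  have zero: "a = 0" if "a \<in> {0..<int p}" "int p dvd a" for a
    using that zdvd_imp_le[of "int p" a] by fastforce
  have z2: "int p dvd 2 * z\<^sup>2"
    if "int p dvd 2 * y - x * z" "int p dvd 2 * x - y * z"
      "int p dvd x\<^sup>2 + y\<^sup>2 + z\<^sup>2 - x * y * z"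
  proof -
    have "2 * z\<^sup>2 = 2 * (x\<^sup>2 + y\<^sup>2 + z\<^sup>2 - x * y * z) - y * (2 * y - x * z) - x * (2 * x - y * z)"
      by (simp add: algebra_simps power2_eq_square)
    then show ?thesis using that by (metis dvd_diff dvd_mult)
  qed
  have M': "int p dvd x\<^sup>2 + y\<^sup>2 + z\<^sup>2 - x * y * z" using M by (simp add: mod_eq_dvd_iff)
  \<comment> \<open>\<open>(x1, y1)\<close> is the image of \<open>(x, y)\<close> under one
    application of the map. \<open>d1\<close> to \<open>d4\<close> are the four recurrence steps
    around the closed cycle \<open>y, x, y1, x1, y, x\<close>.\<close>
  define y1 where "y1 = (x * z - y) mod int p"
  define x1 where "x1 = (y1 * z - x) mod int p"
  have d1: "int p dvd (x * z - y) - y1"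
    unfolding y1_def by (rule dvd_minus_mod)
  have d2: "int p dvd (y1 * z - x) - x1"
    unfolding x1_def by (rule dvd_minus_mod)
  have d3: "int p dvd (x1 * z - y1) - y"
    using dvd_minus_mod y2 unfolding x1_def y1_def by metis
  have d4: "int p dvd (y * z - x1) - x"
    using dvd_minus_mod x2 unfolding x1_def y1_def by metis
  have "int p dvd z"
  proof (rule ccontr)
    assume nz: "\<not> int p dvd z"
    \<comment> \<open>Subtracting recurrence steps with the same outer terms isolates
      \<open>z\<close> times a difference, so cancelling \<open>z\<close> makes the point
      fixed.\<close>
    have "int p dvd z * (y - y1)" using dvd_diff[OF d4 d2] by (simp add: algebra_simps)
    then have "int p dvd y - y1" using pp nz by (simp add: prime_dvd_mult_iff)
    from dvd_diff[OF this d1] have a: "int p dvd 2 * y - x * z" by (simp add: algebra_simps)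
    have "int p dvd z * (x - x1)" using dvd_diff[OF d1 d3] by (simp add: algebra_simps)
    then have "int p dvd x - x1" using pp nz by (simp add: prime_dvd_mult_iff)
    from dvd_diff[OF this d4] have b: "int p dvd 2 * x - y * z" by (simp add: algebra_simps)
    have "int p dvd 2 * z\<^sup>2" using z2 a b M' .
    then show False using pp p2 nz by (simp add: prime_dvd_mult_iff prime_dvd_power_iff)
  qed
  then have z: "z = 0" using zero r(3) by blast
  have "int p dvd x\<^sup>2 + y\<^sup>2" "int p dvd y\<^sup>2 + x\<^sup>2" using M' z by (simp_all add: add.commute)
  then have "int p dvd x" "int p dvd y" by (auto intro: sum_squares_dvd_3_mod_4[OF p])
  then show ?thesis using zero r z by blast
qed

section \<open>The surface and its involutions in integer representatives\<close>

context residues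
begin

lemma res_diff_eq: "x \<ominus> y = (x - y) mod m"
  by (simp add: a_minus_def res_add_eq res_neg_eq mod_simps)

lemma markoff_residue_iff:
  "(x, y, z) \<in> markoff R \<longleftrightarrow> x \<in> {0..<m} \<and> y \<in> {0..<m} \<and> z \<in> {0..<m} \<and>
     (x\<^sup>2 + y\<^sup>2 + z\<^sup>2) mod m = x * y * z mod m"
proof -
  have sq: "a [^] (2::nat) = a\<^sup>2 mod m" for a
    by (simp add: nat_pow_def eval_nat_numeral res_mult_eq res_one_eq mod_simps)
  show ?thesis
    by (auto simp: markoff_def sq res_carrier_eq res_add_eq res_mult_eq mod_simps)
qed

lemma phi_residue:
  "phi1 R (x, y, z) = ((y * z - x) mod m, y, z)"
  "phi2 R (x, y, z) = (x, (x * z - y) mod m, z)"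
  "phi3 R (x, y, z) = (x, y, (x * y - z) mod m)"
  by (simp_all add: phi1_def phi2_def phi3_def res_diff_eq res_mult_eq mod_simps)

end

section \<open>The bound three and its sharpness\<close>

theorem theorem1p2:
  fixes i j :: nat
  assumes "i \<in> {1, 2, 3}" and "j \<in> {1, 2, 3}" and "i \<noteq> j"
  shows "strongly_residually_periodic 3 markoff (\<lambda>R. phi i R \<circ> phi j R) forbidden1 \<and>
         \<not> strongly_residually_periodic 2 markoff (\<lambda>R. phi i R \<circ> phi j R) forbidden1"
proof
  consider "i = 1" "j = 2" | "i = 2" "j = 1" | "i = 1" "j = 3" | "i = 3" "j = 1"
    | "i = 2" "j = 3" | "i = 3" "j = 2"
    using assms by auto
  note ij = this
  show "strongly_residually_periodic 3 markoff (\<lambda>R. phi i R \<circ> phi j R) forbidden1"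
    unfolding strongly_residually_periodic_def
  proof (intro exI[of _ "{2, 3}"] conjI allI impI)
    fix p :: nat
    assume p: "prime p \<and> p \<notin> {2, 3}"
    let ?R = "residue_ring (int p)"
    interpret residues_prime p ?R
      by unfold_locales (use p in auto)
    have p1: "int p > 1" using p prime_gt_1_nat[of p] by auto
    obtain x y where xy: "0 \<le> x" "x < int p" "0 \<le> y" "y < int p"
      "(x\<^sup>2 + y\<^sup>2 + 1) mod int p = x * y mod int p"
      using exists_norm_form_mod_prime[of p] p by auto
    \<comment> \<open>The coordinate set to 1 is the one fixed by the map, namely the one whose
      index is neither \<open>i\<close> nor \<open>j\<close>.\<close>
    define P where "P = (if 1 \<notin> {i, j} then (1, x, y) else if 2 \<notin> {i, j} then (x, 1, y) else (x, y, 1))"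
    have "P \<in> markoff ?R"
      using xy p1 by (auto simp: P_def markoff_residue_iff algebra_simps)
    moreover have "P \<notin> forbidden1 ?R"
      by (auto simp: P_def forbidden1_def res_zero_eq)
    moreover have "((phi i ?R \<circ> phi j ?R) ^^ 3) P = P"
      using ij by cases (use xy in \<open>simp_all add: P_def phi_def phi_residue numeral_3_eq_3 mod_simps\<close>)
    ultimately show "\<exists>P \<in> markoff ?R. P \<notin> forbidden1 ?R \<and>
        (\<exists>n. 1 \<le> n \<and> n \<le> 3 \<and> ((phi i ?R \<circ> phi j ?R) ^^ n) P = P)"
      by (intro bexI[of _ P] conjI exI[of _ 3]) auto
  qed auto
  show "\<not> strongly_residually_periodic 2 markoff (\<lambda>R. phi i R \<circ> phi j R) forbidden1"
  proof
    assume "strongly_residually_periodic 2 markoff (\<lambda>R. phi i R \<circ> phi j R) forbidden1"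
    then obtain S :: "nat set" where S: "finite S"
      "\<And>p. prime p \<Longrightarrow> p \<notin> S \<Longrightarrow> \<exists>P \<in> markoff (residue_ring (int p)). P \<notin> forbidden1 (residue_ring (int p)) \<and>
          (\<exists>n. 1 \<le> n \<and> n \<le> 2 \<and>
            ((phi i (residue_ring (int p)) \<circ> phi j (residue_ring (int p))) ^^ n) P = P)"
      unfolding strongly_residually_periodic_def by blast
    obtain p where p: "prime p" "p mod 4 = 3" "p \<notin> S"
      using infinite_primes_3_mod_4 S(1) by (metis (mono_tags, lifting) finite_subset mem_Collect_eq subsetI)
    let ?R = "residue_ring (int p)"
    let ?f = "phi i ?R \<circ> phi j ?R"
    interpret residues_prime p ?R
      by unfold_locales (use p in auto)
    obtain P n where P: "P \<in> markoff ?R" "P \<notin> forbidden1 ?R"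
      and n: "1 \<le> n" "n \<le> 2" "(?f ^^ n) P = P"
      using S(2)[OF p(1,3)] by blast
    have "n = 1 \<or> n = 2" using n by auto
    \<comment> \<open>A fixed point also satisfies this, so both values of \<open>n\<close> are
      handled at once.\<close>
    then have f2: "?f (?f P) = P" using n(3) by (auto simp: numeral_2_eq_2)
    obtain x y z where xyz: "P = (x, y, z)" by (cases P)
    have r: "x \<in> {0..<int p}" "y \<in> {0..<int p}" "z \<in> {0..<int p}"
      and M: "(x\<^sup>2 + y\<^sup>2 + z\<^sup>2) mod int p = x * y * z mod int p"
      using P(1) by (auto simp: xyz markoff_residue_iff)
    note no_cycle = markoff_no_short_cycle[OF p(1,2)]
    note red = xyz phi_def phi_residue mult.commute
    \<comment> \<open>\<open>no_cycle\<close> updates its second argument first, then its first. It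
      therefore receives coordinate \<open>i\<close>, coordinate \<open>j\<close> and the fixed
      coordinate, in that order.\<close>
    have "x = 0 \<and> y = 0 \<and> z = 0"
      using ij
    proof cases
      case 1
      then show ?thesis using no_cycle[of x y z] r M f2 by (auto simp: red ac_simps)
    next
      case 2
      then show ?thesis using no_cycle[of y x z] r M f2 by (auto simp: red ac_simps)
    next
      case 3
      then show ?thesis using no_cycle[of x z y] r M f2 by (auto simp: red ac_simps)
    next
      case 4
      then show ?thesis using no_cycle[of z x y] r M f2 by (auto simp: red ac_simps)
    next
      case 5
      then show ?thesis using no_cycle[of y z x] r M f2 by (auto simp: red ac_simps)
    next
      case 6
      then show ?thesis using no_cycle[of z y x] r M f2 by (auto simp: red ac_simps)
    qed
    then show False using P(2) by (simp add: xyz forbidden1_def res_zero_eq)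
  qed
qed

end
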